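(* Let $b_n=n(5n+6)+2$ for $n\ge 0$ and $a_n=-4n^4+2n^3$ for $n\ge 1$. Then the generalized continued fraction $$b_0+\cfrac{a_1}{b_{1}+\cfrac{a_{2}}{b_2 + \ddots}}$$ converges and equals $\dfrac{18}{\pi^2}$.
   Context: The value of the generalized continued fraction $b_0+\cfrac{a_1}{b_1+\cfrac{a_2}{b_2+\ddots}}$ is $\lim_{n\to\infty}A_n/B_n$, where $A_n=b_nA_{n-1}+a_nA_{n-2}$ and $B_n=b_nB_{n-1}+a_nB_{n-2}$ for $n\ge1$, with $A_{-1}=1$, $A_0=b_0$, $B_{-1}=0$, $B_0=1$. *)

theory Defs
  imports "HOL-Analysis.Analysis"
begin

(* Canonical numerators A_n and denominators B_n of b 0 + a 1 / (b 1 + a 2 / (b 2 + ...)).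
   The values A_(-1) = 1 and B_(-1) = 0 are inserted in the equations for n = 1;
   a 0 is never used. *)

fun gcf_num :: "(nat \<Rightarrow> 'a::comm_ring_1) \<Rightarrow> (nat \<Rightarrow> 'a) \<Rightarrow> nat \<Rightarrow> 'a" where
  "gcf_num b a 0 = b 0"
| "gcf_num b a (Suc 0) = b 1 * gcf_num b a 0 + a 1 * 1"
| "gcf_num b a (Suc (Suc n)) =
     b (Suc (Suc n)) * gcf_num b a (Suc n) + a (Suc (Suc n)) * gcf_num b a n"

fun gcf_denom :: "(nat \<Rightarrow> 'a::comm_ring_1) \<Rightarrow> (nat \<Rightarrow> 'a) \<Rightarrow> nat \<Rightarrow> 'a" where
  "gcf_denom b a 0 = 1"
| "gcf_denom b a (Suc 0) = b 1 * gcf_denom b a 0 + a 1 * 0"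
| "gcf_denom b a (Suc (Suc n)) =
     b (Suc (Suc n)) * gcf_denom b a (Suc n) + a (Suc (Suc n)) * gcf_denom b a n"

(* The continued fraction converges with value L. The first conjunct excludes
   a limit obtained through the convention x / 0 = 0. *)

definition gcf_has_value :: "(nat \<Rightarrow> real) \<Rightarrow> (nat \<Rightarrow> real) \<Rightarrow> real \<Rightarrow> bool" where
  "gcf_has_value b a L \<longleftrightarrow>
     (\<forall>\<^sub>F n in sequentially. gcf_denom b a n \<noteq> 0) \<and>
     (\<lambda>n. gcf_num b a n / gcf_denom b a n) \<longlonglongrightarrow> L"

end

theory Submission
  imports Defs
begin

text \<open>
  The recurrence is solved by $A_n = (2n+2)!$, and then
  $B_n / A_n = \sum_{k=1}^{n+1} 1 / (k^2 {2k \choose k})$. That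
  $\sum_{k\ge 1} (2\sin t)^{2k} / (k^2 {2k \choose k}) = 2t^2$ for $t = \pi/6$ follows from Taylor's
  formula at $0$: the second derivative of the $k$-th summand is a difference $e_{k-1} - e_k$ with
  $e_0 = 4$ and $e_k = 4 (2\sin t)^{2k} / {2k \choose k}$.
\<close>

section \<open>Inverse central binomial coefficients\<close>

definition inv_central_binom :: "nat \<Rightarrow> real" where
  "inv_central_binom n = (fact n)\<^sup>2 / fact (2 * n)"

text \<open>This is $1 / (k^2 {2k \choose k})$ for $k = n + 1$.\<close>

definition arcsin_sq_coeff :: "nat \<Rightarrow> real" where
  "arcsin_sq_coeff n = (fact n)\<^sup>2 / fact (2 * n + 2)"

lemma fact_double_Suc:
  "fact (2 * n + 2) = (2 * real n + 2) * (2 * real n + 1) * fact (2 * n)"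
  by (simp add: algebra_simps)

text \<open>Together with \<open>inv_central_binom_Suc\<close> this ties two neighbouring inverse
  binomials to one series coefficient, which is what makes the second derivatives telescope.\<close>

lemma inv_central_binom_eq:
  "inv_central_binom n = (2 * real n + 2) * (2 * real n + 1) * arcsin_sq_coeff n"
proof -
  have "2 * real n + 2 \<noteq> 0" "2 * real n + 1 \<noteq> 0"
    by linarith+
  then show ?thesis
    unfolding inv_central_binom_def arcsin_sq_coeff_def fact_double_Suc by simp
qed

lemma inv_central_binom_Suc:
  "inv_central_binom (Suc n) = (real n + 1)\<^sup>2 * arcsin_sq_coeff n"
  by (simp add: inv_central_binom_def arcsin_sq_coeff_def power_mult_distrib del: fact_Suc)
     (simp add: power2_eq_square algebra_simps)

lemma inv_central_binom_nonneg: "inv_central_binom n \<ge> 0"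
  by (simp add: inv_central_binom_def)

lemma arcsin_sq_coeff_pos: "arcsin_sq_coeff n > 0"
  by (simp add: arcsin_sq_coeff_def)

lemma fact_mult_arcsin_sq_coeff:
  "2 * n + 2 = m \<Longrightarrow> fact m * arcsin_sq_coeff n = (fact n)\<^sup>2"
  by (auto simp: arcsin_sq_coeff_def simp del: fact_Suc)

text \<open>Consecutive terms have ratio (n+1)/(2(2n+1)), which is at most (n+1)/(n+2), the ratio of
  consecutive bounds.\<close>

lemma inv_central_binom_le: "inv_central_binom n \<le> 1 / (real n + 1)"
proof (induction n)
  case 0
  then show ?case by (simp add: inv_central_binom_def)
next
  case (Suc n)
  have "(2 * (2 * real n + 1)) * inv_central_binom (Suc n) = (real n + 1) * inv_central_binom n"
    unfolding inv_central_binom_Suc inv_central_binom_eq[of n]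
    by (simp add: power2_eq_square algebra_simps)
  also have "\<dots> \<le> 1"
    using Suc by (simp add: field_simps)
  finally have "(2 * (2 * real n + 1)) * inv_central_binom (Suc n) \<le> 1" .
  moreover have "(real n + 2) * inv_central_binom (Suc n)
      \<le> (2 * (2 * real n + 1)) * inv_central_binom (Suc n)"
    by (intro mult_right_mono inv_central_binom_nonneg) simp
  ultimately show ?case by (simp add: field_simps)
qed

lemma inv_central_binom_tendsto_0: "inv_central_binom \<longlonglongrightarrow> 0"
proof (rule tendsto_sandwich[OF _ _ tendsto_const])
  show "(\<lambda>n. 1 / (real n + 1)) \<longlonglongrightarrow> 0"
    using LIMSEQ_inverse_real_of_nat by (simp add: inverse_eq_divide add.commute)
qed (auto simp: inv_central_binom_nonneg inv_central_binom_le)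

section \<open>Taylor's formula and the value of the series\<close>

text \<open>Put S = 2 sin t and replace the squared cosine factor by 4 - S^2. The terms in S^(2k)
  then have coefficient 4 \<open>inv_central_binom k\<close>, and those in S^(2k+2) have coefficient
  -4 \<open>inv_central_binom (Suc k)\<close>, because (2k+2)(2k+1) + (2k+2) = 4(k+1)^2.\<close>

lemma arcsin_sq_second_deriv_telescope:
  "(\<Sum>k<N. arcsin_sq_coeff k * (2 * real k + 2) *
      ((2 * real k + 1) * (2 * sin t) ^ (2 * k) * (2 * cos t)\<^sup>2 - (2 * sin t) ^ (2 * k + 2)))
    = 4 - 4 * inv_central_binom N * (2 * sin t) ^ (2 * N)"
proof (induction N)
  case 0
  then show ?case by (simp add: inv_central_binom_def)
next
  case (Suc N)
  define S P where "S = 2 * sin t" and "P = S ^ (2 * N)"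
  have c: "(2 * cos t)\<^sup>2 = 4 - S\<^sup>2"
    by (simp add: S_def power_mult_distrib cos_squared_eq)
  have p: "S ^ (2 * N + 2) = P * S\<^sup>2" "S ^ (2 * Suc N) = P * S\<^sup>2"
    by (simp_all add: P_def power_add power2_eq_square)
  show ?case
    unfolding sum.lessThan_Suc Suc.IH inv_central_binom_Suc
    unfolding S_def[symmetric] c p P_def[symmetric] inv_central_binom_eq[of N]
    by algebra
qed

text \<open>The expansion has order 2 for every \<open>N\<close>: the second derivative of the left
  side is the one term that survives the telescoping, and accuracy comes from its factor
  \<open>inv_central_binom N\<close>.\<close>

lemma arcsin_sq_taylor:
  assumes "t > 0"
  obtains \<xi> where "0 < \<xi>" "\<xi> < t"
    "2 * t\<^sup>2 - (\<Sum>k<N. arcsin_sq_coeff k * (2 * sin t) ^ (2 * k + 2))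
      = 2 * inv_central_binom N * (2 * sin \<xi>) ^ (2 * N) * t\<^sup>2"
proof -
  define g where "g = (\<lambda>t. 2 * t\<^sup>2 - (\<Sum>k<N. arcsin_sq_coeff k * (2 * sin t) ^ (2 * k + 2)))"
  define g1 where "g1 = (\<lambda>t. 4 * t -
    (\<Sum>k<N. arcsin_sq_coeff k * (2 * real k + 2) * ((2 * sin t) ^ (2 * k + 1) * (2 * cos t))))"
  define g2 where "g2 = (\<lambda>t. 4 * inv_central_binom N * (2 * sin t) ^ (2 * N))"
  have sin_power_deriv: "((\<lambda>t. (2 * sin t) ^ Suc m) has_real_derivative
      (1 + real m) * ((2 * cos x) * (2 * sin x) ^ m)) (at x)" for m x
    by (intro DERIV_power_Suc) (auto intro!: derivative_eq_intros)
  have cos_deriv: "((\<lambda>t. 2 * cos t) has_real_derivative - (2 * sin x)) (at x)" for x :: real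
    by (auto intro!: derivative_eq_intros)
  have power_deriv: "((\<lambda>t. (2 * sin t) ^ (2 * k + 2)) has_real_derivative
      (2 * real k + 2) * ((2 * sin x) ^ (2 * k + 1) * (2 * cos x))) (at x)" for k x
    using sin_power_deriv[of "2 * k + 1" x] by (simp add: algebra_simps)
  have d1: "(g has_real_derivative g1 x) (at x)" for x
    unfolding g_def g1_def
    by (rule derivative_eq_intros DERIV_sum DERIV_cmult power_deriv refl
        | simp add: algebra_simps)+
  have summand_deriv: "((\<lambda>t. (2 * sin t) ^ (2 * k + 1) * (2 * cos t)) has_real_derivative
      (2 * real k + 1) * (2 * sin x) ^ (2 * k) * (2 * cos x)\<^sup>2 - (2 * sin x) ^ (2 * k + 2)) (at x)"
    for k x
    using DERIV_mult[OF sin_power_deriv[of "2 * k" x] cos_deriv[of x]]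
    by (simp add: algebra_simps power2_eq_square)
  have "(g1 has_real_derivative 4 - (\<Sum>k<N. arcsin_sq_coeff k * (2 * real k + 2) *
      ((2 * real k + 1) * (2 * sin x) ^ (2 * k) * (2 * cos x)\<^sup>2 - (2 * sin x) ^ (2 * k + 2)))) (at x)"
    for x
    unfolding g1_def
    by (rule derivative_eq_intros summand_deriv DERIV_sum DERIV_cmult refl | simp)+
  then have d2: "(g1 has_real_derivative g2 x) (at x)" for x
    unfolding arcsin_sq_second_deriv_telescope g2_def by simp
  define diff where "diff = (\<lambda>m::nat. if m = 0 then g else if m = 1 then g1 else g2)"
  have "\<exists>\<xi>>0. \<xi> < t \<and> g t = (\<Sum>m<2. diff m 0 / fact m * t ^ m) + diff 2 \<xi> / fact 2 * t ^ 2"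
  proof (rule Maclaurin)
    show "\<forall>m s. m < 2 \<and> 0 \<le> s \<and> s \<le> t \<longrightarrow> DERIV (diff m) s :> diff (Suc m) s"
      using d1 d2 by (auto simp: diff_def less_2_cases_iff)
  qed (use assms in \<open>auto simp: diff_def\<close>)
  \<comment> \<open>All powers of the sine here have positive exponent, so only the Lagrange
    remainder is left.\<close>
  moreover have "g 0 = 0" "g1 0 = 0"
    by (simp_all add: g_def g1_def)
  ultimately obtain \<xi> where "0 < \<xi>" "\<xi> < t" "g t = g2 \<xi> / 2 * t\<^sup>2"
    by (auto simp: diff_def numeral_2_eq_2)
  then show thesis
    by (intro that[of \<xi>]) (simp_all add: g_def g2_def)
qed

text \<open>At t = pi/6 the base 2 sin t is 1, so the powers disappear and 2t^2 is the claimed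
  sum.\<close>

lemma arcsin_sq_coeff_sums: "arcsin_sq_coeff sums (pi\<^sup>2 / 18)"
proof -
  have bounds: "0 \<le> pi\<^sup>2 / 18 - (\<Sum>k<N. arcsin_sq_coeff k) \<and>
      pi\<^sup>2 / 18 - (\<Sum>k<N. arcsin_sq_coeff k) \<le> inv_central_binom N * (pi\<^sup>2 / 18)" for N
  proof -
    obtain \<xi> where \<xi>: "0 < \<xi>" "\<xi> < pi / 6"
      "2 * (pi / 6)\<^sup>2 - (\<Sum>k<N. arcsin_sq_coeff k * (2 * sin (pi / 6)) ^ (2 * k + 2))
        = 2 * inv_central_binom N * (2 * sin \<xi>) ^ (2 * N) * (pi / 6)\<^sup>2"
      by (rule arcsin_sq_taylor[of "pi / 6" N]) auto
    \<comment> \<open>The point \<xi> varies with \<open>N\<close>; keeping 2 sin \<xi> in [0,1]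
      bounds the remainder independently of it.\<close>
    have "sin \<xi> \<ge> 0"
      using \<xi>(1,2) by (intro sin_ge_zero) auto
    moreover have "sin \<xi> \<le> sin (pi / 6)"
      using \<xi>(1,2) by (intro sin_monotone_2pi_le) auto
    ultimately have "0 \<le> 2 * sin \<xi>" "2 * sin \<xi> \<le> 1"
      by (auto simp: sin_30)
    then have pw: "(2 * sin \<xi>) ^ (2 * N) \<le> 1" "0 \<le> (2 * sin \<xi>) ^ (2 * N)"
      by (rule power_le_one) simp
    have eq: "pi\<^sup>2 / 18 - (\<Sum>k<N. arcsin_sq_coeff k)
        = inv_central_binom N * (pi\<^sup>2 / 18) * (2 * sin \<xi>) ^ (2 * N)"
      using \<xi>(3) by (simp add: sin_30 power_divide)
    have nn: "0 \<le> inv_central_binom N * (pi\<^sup>2 / 18)"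
      by (simp add: inv_central_binom_nonneg)
    show ?thesis
      unfolding eq using nn pw by (auto intro: mult_left_le)
  qed
  have "(\<lambda>N. pi\<^sup>2 / 18 - (\<Sum>k<N. arcsin_sq_coeff k)) \<longlonglongrightarrow> 0"
  proof (rule tendsto_sandwich[OF _ _ tendsto_const])
    show "(\<lambda>N. inv_central_binom N * (pi\<^sup>2 / 18)) \<longlonglongrightarrow> 0"
      using tendsto_mult_left_zero[OF inv_central_binom_tendsto_0] .
  qed (use bounds in auto)
  from tendsto_diff[OF tendsto_const[of "pi\<^sup>2 / 18"] this] show ?thesis
    by (simp add: sums_def)
qed

section \<open>Closed forms of the canonical numerators and denominators\<close>

lemma double_Suc_shift: "2 * Suc n + 2 = 2 * n + 4" "2 * Suc (Suc n) + 2 = 2 * n + 6"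
  by simp_all

lemma fact_double_add_4:
  "fact (2 * n + 4) = (2 * real n + 4) * (2 * real n + 3) * fact (2 * n + 2)"
proof -
  have shifts: "2 * (n + 1) = 2 * n + 2" "2 * n + 2 + 2 = 2 * n + 4"
    by simp_all
  show ?thesis
    using fact_double_Suc[of "n + 1"] unfolding shifts by (simp add: algebra_simps del: fact_Suc)
qed

lemma fact_double_add_6:
  "fact (2 * n + 6) = (2 * real n + 6) * (2 * real n + 5) * fact (2 * n + 4)"
proof -
  have shifts: "2 * Suc n + 4 = 2 * n + 6" "2 * Suc n + 2 = 2 * n + 4"
    by simp_all
  show ?thesis
    using fact_double_add_4[of "Suc n"] unfolding shifts by (simp add: algebra_simps del: fact_Suc)
qed

context
  fixes a b :: "nat \<Rightarrow> real"
  assumes b_eq: "\<And>n. b n = real n * (5 * real n + 6) + 2"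
    and a_eq: "\<And>n. n \<ge> 1 \<Longrightarrow> a n = - 4 * real n ^ 4 + 2 * real n ^ 3"
begin

text \<open>With m = n+2, \<open>b m\<close> is (2m+2)(2m+1) + m^2 and \<open>a m\<close> is -m^2 *
  2m(2m-1). Since (2m)! = 2m(2m-1) * (2m-2)!, the two contributions of m^2 cancel.\<close>

lemma fact_recurrence:
  "fact (2 * n + 6) = b (n + 2) * fact (2 * n + 4) + a (n + 2) * fact (2 * n + 2)"
proof -
  have ab: "b (n + 2) = (real n + 2) * (5 * (real n + 2) + 6) + 2"
    "a (n + 2) = - 4 * (real n + 2) ^ 4 + 2 * (real n + 2) ^ 3"
    by (simp_all add: a_eq b_eq add.commute)
  show ?thesis
    unfolding fact_double_add_6 fact_double_add_4 ab by algebra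
qed

lemma gcf_num_eq: "gcf_num b a n = fact (2 * n + 2)"
proof (induction n rule: induct_nat_012)
  case 0
  then show ?case by (simp add: b_eq)
next
  case 1
  then show ?case by (simp add: a_eq b_eq fact_numeral)
next
  case (ge2 n)
  then show ?case
    unfolding gcf_num.simps double_Suc_shift using fact_recurrence[of n]
    by (simp add: add.commute del: fact_Suc)
qed

lemma gcf_denom_eq: "gcf_denom b a n = fact (2 * n + 2) * (\<Sum>k\<le>n. arcsin_sq_coeff k)"
proof (induction n rule: induct_nat_012)
  case 0
  then show ?case by (simp add: arcsin_sq_coeff_def)
next
  case 1
  then show ?case by (simp add: b_eq arcsin_sq_coeff_def fact_numeral)
next
  case (ge2 n)
  define W where "W = (\<Sum>k\<le>n. arcsin_sq_coeff k)"
  define u v where "u = arcsin_sq_coeff (n + 1)" and "v = arcsin_sq_coeff (n + 2)"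
  have u: "fact (2 * n + 4) * u = (fact (n + 1))\<^sup>2"
    unfolding u_def by (rule fact_mult_arcsin_sq_coeff) simp
  have "fact (2 * n + 6) * v = (fact (n + 2))\<^sup>2"
    unfolding v_def by (rule fact_mult_arcsin_sq_coeff) simp
  also have "\<dots> = (real n + 2)\<^sup>2 * (fact (n + 1))\<^sup>2"
    by (simp add: power2_eq_square algebra_simps)
  finally have v: "fact (2 * n + 6) * v = (real n + 2)\<^sup>2 * (fact (2 * n + 4) * u)"
    unfolding u .
  \<comment> \<open>Multiplied by (2n+4)! \<open>u\<close>, the first summand yields (2n+6)!
    \<open>u\<close> and the second, by the preceding relation, (2n+6)! \<open>v\<close>. The
    multiple of \<open>W\<close> is handled by \<open>fact_recurrence\<close>.\<close>
  have b: "b (n + 2) = (2 * real n + 6) * (2 * real n + 5) + (real n + 2)\<^sup>2"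
    by (simp add: b_eq power2_eq_square algebra_simps)
  have IH: "gcf_denom b a n = fact (2 * n + 2) * W"
    "gcf_denom b a (Suc n) = fact (2 * n + 4) * (W + u)"
    using ge2 unfolding double_Suc_shift by (simp_all add: W_def u_def del: fact_Suc)
  have "gcf_denom b a (Suc (Suc n))
      = (b (n + 2) * fact (2 * n + 4) + a (n + 2) * fact (2 * n + 2)) * W
        + b (n + 2) * (fact (2 * n + 4) * u)"
    unfolding gcf_denom.simps IH by (simp add: algebra_simps del: fact_Suc)
  also have "\<dots> = fact (2 * n + 6) * W + fact (2 * n + 6) * u + fact (2 * n + 6) * v"
    unfolding fact_recurrence[symmetric] v unfolding fact_double_add_6 b by algebra
  also have "\<dots> = fact (2 * n + 6) * (\<Sum>k\<le>Suc (Suc n). arcsin_sq_coeff k)"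
    by (simp add: W_def u_def v_def algebra_simps del: fact_Suc)
  finally show ?case
    by (simp only: double_Suc_shift(2))
qed

end

theorem theorem1p6:
  fixes a b :: "nat \<Rightarrow> real"
  assumes "\<And>n. b n = real n * (5 * real n + 6) + 2"
    and "\<And>n. n \<ge> 1 \<Longrightarrow> a n = - 4 * real n ^ 4 + 2 * real n ^ 3"
  shows "gcf_has_value b a (18 / pi\<^sup>2)"
proof -
  \<comment> \<open>Positivity of the partial sums keeps every denominator nonzero.\<close>
  have pos: "(\<Sum>k\<le>n. arcsin_sq_coeff k) > 0" for n
    by (intro sum_pos arcsin_sq_coeff_pos) auto
  have denom: "gcf_denom b a n = fact (2 * n + 2) * (\<Sum>k\<le>n. arcsin_sq_coeff k)" for n
    using assms by (rule gcf_denom_eq)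
  have num: "gcf_num b a n = fact (2 * n + 2)" for n
    using assms by (rule gcf_num_eq)
  have "gcf_denom b a n \<noteq> 0" for n
    using pos[of n] fact_nonzero[of "2 * n + 2", where 'a = real]
    by (simp add: denom del: fact_Suc)
  moreover have "gcf_num b a n / gcf_denom b a n = inverse (\<Sum>k\<le>n. arcsin_sq_coeff k)" for n
    using fact_nonzero[of "2 * n + 2", where 'a = real]
    by (simp add: num denom inverse_eq_divide del: fact_Suc)
  \<comment> \<open>The partial sums here include the index \<open>n\<close>, hence
    \<open>sums_def_le\<close>; inversion preserves the limit as it is nonzero.\<close>
  moreover have "(\<lambda>n. inverse (\<Sum>k\<le>n. arcsin_sq_coeff k)) \<longlonglongrightarrow> inverse (pi\<^sup>2 / 18)"
    using arcsin_sq_coeff_sums by (intro tendsto_inverse) (simp_all add: sums_def_le)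
  ultimately show ?thesis
    by (simp add: gcf_has_value_def)
qed

end
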